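(* Consider the planar system $$\dot x=y,\qquad \dot y=(\mu+x^2-x^4)y+\beta x-\epsilon x^3 .$$ If one of the following conditions holds: (c1) $\epsilon\le0$, $\beta>0$, $\mu\in\mathbb R$; (c2) $\epsilon<0$, $\beta=0$, $\mu\in\mathbb R$; (c3) $\epsilon>0$, $\beta=0$, $\mu\le-\frac{5}{36}$; (c4) $\epsilon\in\mathbb R$, $\beta\in\mathbb R$, $\mu\le-\frac14$; then the system exhibits neither limit cycles nor homoclinic loops.
   Context: Here $x,y$ are real state variables and $\mu,\beta,\epsilon$ are real parameters; throughout, $\beta$ and $\epsilon$ are assumed not to be both $0$. *)

theory Defs
  imports "HOL-Analysis.Analysis"
begin

text \<open>Orbits are handled through solutions defined for all times. This loses nothing, since a
  maximal solution of a smooth system that is periodic or bounded is defined on the whole line.\<close>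

definition solution :: "('a::real_normed_vector \<Rightarrow> 'a) \<Rightarrow> (real \<Rightarrow> 'a) \<Rightarrow> bool" where
  "solution X \<gamma> \<longleftrightarrow> (\<forall>t. (\<gamma> has_vector_derivative X (\<gamma> t)) (at t))"

definition periodic_orbit :: "('a::real_normed_vector \<Rightarrow> 'a) \<Rightarrow> 'a set \<Rightarrow> bool" where
  "periodic_orbit X \<Gamma> \<longleftrightarrow>
     (\<exists>\<gamma> T. solution X \<gamma> \<and> T > 0 \<and> (\<forall>t. \<gamma> (t + T) = \<gamma> t) \<and>
        \<not> \<gamma> constant_on UNIV \<and> \<Gamma> = range \<gamma>)"

text \<open>A limit cycle is an isolated periodic orbit: some neighbourhood of it contains no other
  periodic orbit. In particular the orbits of a period annulus are not limit cycles.\<close>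

definition limit_cycle :: "('a::real_normed_vector \<Rightarrow> 'a) \<Rightarrow> 'a set \<Rightarrow> bool" where
  "limit_cycle X \<Gamma> \<longleftrightarrow> periodic_orbit X \<Gamma> \<and>
     (\<exists>U. open U \<and> \<Gamma> \<subseteq> U \<and> (\<forall>\<Gamma>'. periodic_orbit X \<Gamma>' \<and> \<Gamma>' \<subseteq> U \<longrightarrow> \<Gamma>' = \<Gamma>))"

text \<open>A homoclinic loop is an equilibrium together with a nonconstant orbit tending to it in both
  time directions. The equilibrium is not required to be a saddle, nor to be hyperbolic.\<close>

definition homoclinic_loop :: "('a::real_normed_vector \<Rightarrow> 'a) \<Rightarrow> 'a set \<Rightarrow> bool" where
  "homoclinic_loop X \<Gamma> \<longleftrightarrow>
     (\<exists>\<gamma> p. X p = 0 \<and> solution X \<gamma> \<and> \<not> \<gamma> constant_on UNIV \<and>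
        (\<gamma> \<longlongrightarrow> p) at_top \<and> (\<gamma> \<longlongrightarrow> p) at_bot \<and> \<Gamma> = insert p (range \<gamma>))"

definition lienard_field :: "real \<Rightarrow> real \<Rightarrow> real \<Rightarrow> real \<times> real \<Rightarrow> real \<times> real" where
  "lienard_field \<mu> \<beta> \<epsilon> = (\<lambda>(x, y). (y, (\<mu> + x^2 - x^4) * y + \<beta> * x - \<epsilon> * x^3))"

end

theory Submission
  imports Defs
begin

text \<open>Along a periodic orbit or a homoclinic loop a monotone continuous quantity is constant. The
  energy \<open>y\<^sup>2 / 2 - \<beta> x\<^sup>2 / 2 + \<epsilon> x^4 / 4\<close> has derivative \<open>(\<mu> + x\<^sup>2 - x^4) y\<^sup>2\<close>, which is
  nonpositive for \<open>\<mu> \<le> - 1/4\<close>. For \<open>\<beta> = 0\<close>, put \<open>F x = \<mu> x + x^3 / 3 - x^5 / 5\<close> and pass to the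
  Lienard variable \<open>z = y - F x\<close>: then \<open>z\<^sup>2 / 2 + \<epsilon> x^4 / 4\<close> has derivative \<open>\<epsilon> x^3 F x\<close>, and
  \<open>\<mu> = - 5/36\<close> is where the discriminant of \<open>F x / x\<close> in \<open>x\<^sup>2\<close> vanishes. In both cases the
  derivative vanishes identically only on equilibria. When \<open>\<epsilon> \<le> 0 \<le> \<beta>\<close>, the restoring force
  points outwards, so \<open>x\<^sup>2\<close> has no positive maximum along an orbit.\<close>

section \<open>Monotone quantities along recurrent curves\<close>

text \<open>Common abstraction of periodic and homoclinic behaviour. The limit \<open>p\<close> is
  not asked to be an equilibrium, so that the notion passes to real functions of the orbit.\<close>

definition recurrent :: "(real \<Rightarrow> 'a::topological_space) \<Rightarrow> bool" where
  "recurrent \<gamma> \<longleftrightarrow> (\<exists>T>0. \<forall>t. \<gamma> (t + T) = \<gamma> t) \<or>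
     (\<exists>p. (\<gamma> \<longlongrightarrow> p) at_top \<and> (\<gamma> \<longlongrightarrow> p) at_bot)"

lemma recurrent_compose:
  assumes "recurrent \<gamma>" "continuous_on UNIV V"
  shows "recurrent (\<lambda>t. V (\<gamma> t))"
proof -
  have "((\<lambda>t. V (\<gamma> t)) \<longlongrightarrow> V p) F" if "(\<gamma> \<longlongrightarrow> p) F" for p F
    using continuous_on_tendsto_compose[OF assms(2) that] by simp
  then show ?thesis
    using assms(1) unfolding recurrent_def by metis
qed

lemma periodic_add_of_nat_mult:
  fixes v :: "real \<Rightarrow> 'a"
  assumes "\<And>t. v (t + T) = v t"
  shows "v (t + of_nat n * T) = v t"
proof (induction n)
  case (Suc n)
  then show ?case
    using assms[of "t + of_nat n * T"] by (simp add: algebra_simps)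
qed simp

text \<open>For a period \<open>T\<close>, the value at \<open>b\<close> is squeezed between those
  at \<open>a\<close> and at some \<open>a + n * T\<close> beyond \<open>b\<close>, which agree.
  Otherwise the common limit bounds every value from both sides.\<close>

lemma antimono_recurrent_constant:
  fixes v :: "real \<Rightarrow> real"
  assumes v: "antimono v" and "recurrent v"
  shows "v s = v t"
  using assms(2) unfolding recurrent_def
proof (elim disjE exE conjE)
  fix T :: real
  assume T: "0 < T" "\<forall>t. v (t + T) = v t"
  have "v a = v b" if "a \<le> b" for a b
  proof -
    obtain n :: nat where "b - a \<le> of_nat n * T"
      using reals_Archimedean3[OF T(1)] less_imp_le by blast
    then have "v (a + of_nat n * T) \<le> v b"
      using v by (simp add: antimonoD)
    then show ?thesis
      using periodic_add_of_nat_mult[of v T a n] T(2) antimonoD[OF v that] by simp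
  qed
  then show ?thesis
    by (metis linear)
next
  fix p
  assume top: "(v \<longlongrightarrow> p) at_top" and bot: "(v \<longlongrightarrow> p) at_bot"
  have "v r = p" for r
  proof (rule antisym)
    have "\<forall>\<^sub>F s in at_bot. v r \<le> v s"
      using eventually_le_at_bot[of r] by eventually_elim (use v antimonoD in blast)
    then show "v r \<le> p"
      by (intro tendsto_lowerbound[OF bot]) auto
    have "\<forall>\<^sub>F s in at_top. v s \<le> v r"
      using eventually_ge_at_top[of r] by eventually_elim (use v antimonoD in blast)
    then show "p \<le> v r"
      by (intro tendsto_upperbound[OF top]) auto
  qed
  then show ?thesis
    by simp
qed

lemma recurrent_nonpos_derivative_zero:
  fixes v d :: "real \<Rightarrow> real"
  assumes "recurrent v"
    and d: "\<And>t. (v has_real_derivative d t) (at t)" "\<And>t. d t \<le> 0"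
  shows "d t = 0"
proof -
  have "antimono v"
    by (rule antimonoI, rule DERIV_nonpos_imp_nonincreasing) (use d in auto)
  then have "v = (\<lambda>_. v t)"
    using antimono_recurrent_constant[OF _ assms(1)] by blast
  then have "(v has_real_derivative 0) (at t)"
    by (metis DERIV_const)
  then show ?thesis
    using d(1) DERIV_unique by blast
qed

text \<open>Where \<open>y\<close> is nonzero it stays so nearby, hence \<open>x\<close> moves
  continuously inside a finite set, is locally constant, and has derivative 0. This handles the
  lines on which a dissipation rate vanishes.\<close>

lemma derivative_zero_or_finite_values:
  fixes x y :: "real \<Rightarrow> real"
  assumes x: "\<And>t. (x has_real_derivative y t) (at t)" and y: "isCont y t"
    and "finite S" and S: "\<And>t. y t = 0 \<or> x t \<in> S"
  shows "y t = 0"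
proof (rule ccontr)
  assume "y t \<noteq> 0"
  then have "\<forall>\<^sub>F s in nhds t. y s \<noteq> 0"
    using y unfolding isCont_def tendsto_at_iff_tendsto_nhds
    by (intro tendsto_imp_eventually_ne)
  moreover have "\<forall>\<^sub>F s in nhds t. x s \<in> - (S - {x t})"
  proof -
    have "filterlim x (nhds (x t)) (nhds t)"
      using DERIV_isCont[OF x] by (simp add: isCont_def tendsto_at_iff_tendsto_nhds)
    moreover have "open (- (S - {x t}))"
      using \<open>finite S\<close> by (intro open_Compl finite_imp_closed) auto
    ultimately show ?thesis
      by (rule topological_tendstoD) auto
  qed
  ultimately have "\<forall>\<^sub>F s in nhds t. x s = x t"
    by eventually_elim (use S in blast)
  then have "(x has_real_derivative 0) (at t)"
    using DERIV_cong_ev[OF refl _ refl, of x "\<lambda>_. x t" t 0] by simp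
  then show False
    using \<open>y t \<noteq> 0\<close> x DERIV_unique by blast
qed

section \<open>Existence of maxima and the second derivative test\<close>

lemma periodic_attains_max:
  fixes u :: "real \<Rightarrow> real"
  assumes "continuous_on UNIV u" "T > 0" "\<And>t. u (t + T) = u t"
  obtains t0 where "\<And>t. u t \<le> u t0"
proof -
  obtain t0 where t0: "\<And>t. t \<in> {0..T} \<Longrightarrow> u t \<le> u t0"
    using continuous_attains_sup[of "{0..T}" u] continuous_on_subset[OF assms(1)] assms(2)
    by force
  have "u t \<le> u t0" for t
  proof -
    define n where "n = nat \<bar>\<lfloor>t / T\<rfloor>\<bar>"
    define r where "r = t - of_int \<lfloor>t / T\<rfloor> * T"
    have "of_int \<lfloor>t / T\<rfloor> * T \<le> t" "t < (of_int \<lfloor>t / T\<rfloor> + 1) * T"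
      using floor_divide_lower[OF \<open>T > 0\<close>] floor_divide_upper[OF \<open>T > 0\<close>] by auto
    then have "r \<in> {0..T}"
      unfolding r_def by (simp add: algebra_simps)
    \<comment> \<open>Periodicity is available for natural multiples of \<open>T\<close> only, so
      for negative \<open>t\<close> the shift goes from \<open>t\<close> to
      \<open>r\<close>.\<close>
    moreover have "t = r + of_nat n * T \<or> r = t + of_nat n * T"
      unfolding r_def n_def by (cases "\<lfloor>t / T\<rfloor> \<ge> 0") (auto simp: algebra_simps)
    then have "u t = u r"
      using periodic_add_of_nat_mult[of u T, OF assms(3)] by metis
    ultimately show ?thesis
      using t0 by simp
  qed
  then show thesis
    using that by blast
qed

text \<open>Outside a compact interval containing \<open>t1\<close>, the values stay below
  \<open>u t1\<close>, so the maximum over the interval is global.\<close>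

lemma homoclinic_attains_max:
  fixes u :: "real \<Rightarrow> real"
  assumes "continuous_on UNIV u" "(u \<longlongrightarrow> p) at_top" "(u \<longlongrightarrow> p) at_bot" "u t1 > p"
  obtains t0 where "\<And>t. u t \<le> u t0"
proof -
  obtain b where b: "\<And>t. t \<ge> b \<Longrightarrow> u t < u t1"
    using order_tendstoD(2)[OF assms(2,4)] unfolding eventually_at_top_linorder by blast
  obtain a where a: "\<And>t. t \<le> a \<Longrightarrow> u t < u t1"
    using order_tendstoD(2)[OF assms(3,4)] unfolding eventually_at_bot_linorder by blast
  have t1: "t1 \<in> {a..b}"
    using a[of t1] b[of t1] by force
  obtain t0 where t0: "\<And>t. t \<in> {a..b} \<Longrightarrow> u t \<le> u t0"
    using continuous_attains_sup[of "{a..b}" u] continuous_on_subset[OF assms(1)] t1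
    by force
  have "u t \<le> u t0" for t
    using t0[of t] t0[OF t1] a[of t] b[of t] by force
  then show thesis
    using that by blast
qed

text \<open>If \<open>c\<close> were positive, \<open>u'\<close> would be positive just to the right
  of its zero \<open>t0\<close>, and the mean value theorem would give a value above the
  maximum.\<close>

lemma max_second_derivative_nonpos:
  fixes u u' :: "real \<Rightarrow> real"
  assumes u: "\<And>t. (u has_real_derivative u' t) (at t)"
    and u': "(u' has_real_derivative c) (at t0)"
    and max: "\<And>t. u t \<le> u t0"
  shows "c \<le> 0"
proof (rule ccontr)
  assume "\<not> c \<le> 0"
  then obtain d where d: "d > 0" "\<And>h. 0 < h \<Longrightarrow> h < d \<Longrightarrow> u' t0 < u' (t0 + h)"
    using DERIV_pos_inc_right[OF u'] by auto
  have "u' t0 = 0"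
    by (rule DERIV_local_max[OF u, of 1]) (use max in auto)
  then have pos: "u' s > 0" if "t0 < s" "s < t0 + d" for s
    using d(2)[of "s - t0"] that by simp
  obtain s where "t0 < s" "s < t0 + d / 2" "u (t0 + d / 2) - u t0 = (t0 + d / 2 - t0) * u' s"
    using MVT2[of t0 "t0 + d / 2" u u'] u d(1) by auto
  then have "u (t0 + d / 2) > u t0"
    using mult_pos_pos[OF d(1) pos[of s]] d(1) by simp
  then show False
    using max[of "t0 + d / 2"] by simp
qed

section \<open>Orbits with a monotone energy\<close>

lemma lienard_solution_derivatives:
  assumes "solution (lienard_field \<mu> \<beta> \<epsilon>) \<gamma>"
  defines "x \<equiv> \<lambda>t. fst (\<gamma> t)" and "y \<equiv> \<lambda>t. snd (\<gamma> t)"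
  shows "(x has_real_derivative y t) (at t)"
    and "(y has_real_derivative ((\<mu> + (x t)^2 - (x t)^4) * y t + \<beta> * x t - \<epsilon> * (x t)^3)) (at t)"
proof -
  have \<gamma>: "(\<gamma> has_vector_derivative lienard_field \<mu> \<beta> \<epsilon> (\<gamma> t)) (at t)"
    using assms(1) unfolding solution_def by blast
  show "(x has_real_derivative y t) (at t)"
    using bounded_linear.has_vector_derivative[OF bounded_linear_fst \<gamma>]
    unfolding x_def y_def has_real_derivative_iff_has_vector_derivative
    by (simp add: lienard_field_def case_prod_beta)
  show "(y has_real_derivative ((\<mu> + (x t)^2 - (x t)^4) * y t + \<beta> * x t - \<epsilon> * (x t)^3)) (at t)"
    using bounded_linear.has_vector_derivative[OF bounded_linear_snd \<gamma>]
    unfolding x_def y_def has_real_derivative_iff_has_vector_derivative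
    by (simp add: lienard_field_def case_prod_beta)
qed

lemma lienard_solution_constant:
  assumes sol: "solution (lienard_field \<mu> \<beta> \<epsilon>) \<gamma>"
    and S: "finite S" "\<And>t. snd (\<gamma> t) = 0 \<or> fst (\<gamma> t) \<in> S"
  shows "\<gamma> constant_on UNIV"
proof -
  note der = lienard_solution_derivatives[OF sol]
  have y0: "snd (\<gamma> t) = 0" for t
    by (rule derivative_zero_or_finite_values[OF der(1) DERIV_isCont[OF der(2)] S])
  then have "((\<lambda>t. fst (\<gamma> t)) has_real_derivative 0) (at t)" for t
    using der(1)[of t] by simp
  then have "fst (\<gamma> s) = fst (\<gamma> t)" for s t
    using DERIV_isconst_all[of "\<lambda>t. fst (\<gamma> t)"] by blast
  then have "\<gamma> t = (fst (\<gamma> 0), 0)" for t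
    by (metis y0 prod.collapse)
  then show ?thesis
    unfolding constant_on_def by blast
qed

lemma lienard_recurrent_constant_dissipative:
  assumes sol: "solution (lienard_field \<mu> \<beta> \<epsilon>) \<gamma>" and rec: "recurrent \<gamma>"
    and \<mu>: "\<mu> \<le> - (1/4)"
  shows "\<gamma> constant_on UNIV"
proof -
  define x y where "x t = fst (\<gamma> t)" and "y t = snd (\<gamma> t)" for t
  note der = lienard_solution_derivatives[OF sol, folded x_def y_def]
  define V where "V = (\<lambda>(x, y). y^2 / 2 - \<beta> * x^2 / 2 + \<epsilon> * x^4 / 4 :: real)"
  have "continuous_on UNIV V"
    unfolding V_def case_prod_beta by (intro continuous_intros) auto
  then have recV: "recurrent (\<lambda>t. V (\<gamma> t))"
    using rec by (rule recurrent_compose[rotated])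
  have derV: "((\<lambda>t. V (\<gamma> t)) has_real_derivative (\<mu> + (x t)^2 - (x t)^4) * (y t)^2) (at t)" for t
    unfolding V_def case_prod_beta x_def[symmetric] y_def[symmetric]
    by (rule derivative_eq_intros der refl | simp)+
      (simp add: algebra_simps power2_eq_square power3_eq_cube)
  \<comment> \<open>Completing the square: for \<open>\<mu>\<close> at most -1/4 the damping is
    nonpositive, and it vanishes only if \<open>\<mu>\<close> is -1/4 and \<open>a^2\<close> is
    1/2.\<close>
  have f: "\<mu> + a^2 - a^4 = (\<mu> + 1/4) - (a^2 - 1/2)^2" for a :: real
    by (simp add: power2_eq_square power4_eq_xxxx algebra_simps)
  have "(\<mu> + (x t)^2 - (x t)^4) * (y t)^2 \<le> 0" for t
    using \<mu> zero_le_power2[of "(x t)^2 - 1/2"] unfolding f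
    by (intro mult_nonpos_nonneg) (linarith, simp)
  then have zero: "(\<mu> + (x t)^2 - (x t)^4) * (y t)^2 = 0" for t
    by (rule recurrent_nonpos_derivative_zero[OF recV derV])
  have "y t = 0 \<or> x t \<in> {sqrt (1/2), - sqrt (1/2)}" for t
  proof (cases "y t = 0")
    case False
    then have "(\<mu> + 1/4) - ((x t)^2 - 1/2)^2 = 0"
      using zero[of t] unfolding f by simp
    then have "((x t)^2 - 1/2)^2 = 0"
      using \<mu> zero_le_power2[of "(x t)^2 - 1/2"] by linarith
    then have "(x t)^2 = (sqrt (1/2))^2"
      by simp
    then show ?thesis
      unfolding power2_eq_iff by blast
  qed simp
  then show ?thesis
    unfolding x_def y_def
    by (intro lienard_solution_constant[OF sol, of "{sqrt (1/2), - sqrt (1/2)}"]) auto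
qed

lemma lienard_recurrent_constant_pure_cubic:
  assumes sol: "solution (lienard_field \<mu> 0 \<epsilon>) \<gamma>" and rec: "recurrent \<gamma>"
    and \<epsilon>: "\<epsilon> > 0" and \<mu>: "\<mu> \<le> - (5/36)"
  shows "\<gamma> constant_on UNIV"
proof -
  define x y where "x t = fst (\<gamma> t)" and "y t = snd (\<gamma> t)" for t
  note der = lienard_solution_derivatives[OF sol, folded x_def y_def]
  define V where "V = (\<lambda>(x, y). (y - (\<mu> * x + x^3 / 3 - x^5 / 5))^2 / 2 + \<epsilon> * x^4 / 4 :: real)"
  \<comment> \<open>This is \<open>\<epsilon> * a^3\<close> times the primitive of the damping, with
    a factor \<open>a\<close> taken out of the primitive.\<close>
  define d where "d = (\<lambda>a::real. \<epsilon> * a^4 * (\<mu> + a^2 / 3 - a^4 / 5))"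
  have "continuous_on UNIV V"
    unfolding V_def case_prod_beta by (intro continuous_intros) auto
  then have recV: "recurrent (\<lambda>t. V (\<gamma> t))"
    using rec by (rule recurrent_compose[rotated])
  have derV: "((\<lambda>t. V (\<gamma> t)) has_real_derivative d (x t)) (at t)" for t
    unfolding V_def case_prod_beta x_def[symmetric] y_def[symmetric]
    by (rule derivative_eq_intros der refl | simp)+
      (simp add: d_def field_simps eval_nat_numeral)
  have f: "\<mu> + a^2 / 3 - a^4 / 5 = (\<mu> + 5/36) - (a^2 - 5/6)^2 / 5" for a :: real
    by (simp add: power2_eq_square power4_eq_xxxx field_simps)
  have "d (x t) \<le> 0" for t
    using \<mu> \<epsilon> zero_le_power2[of "(x t)^2 - 5/6"] unfolding d_def f
    by (intro mult_nonneg_nonpos) (simp, linarith)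
  then have zero: "d (x t) = 0" for t
    by (rule recurrent_nonpos_derivative_zero[OF recV derV])
  \<comment> \<open>Since \<open>d\<close> does not involve \<open>y\<close>, the position itself is
    confined to a finite set; 0 comes from the factor \<open>a^4\<close>, the other two from
    equality in the completed square.\<close>
  have "x t \<in> {0, sqrt (5/6), - sqrt (5/6)}" for t
  proof (cases "x t = 0")
    case False
    then have "(\<mu> + 5/36) - ((x t)^2 - 5/6)^2 / 5 = 0"
      using zero[of t] \<epsilon> unfolding d_def f by simp
    then have "((x t)^2 - 5/6)^2 = 0"
      using \<mu> zero_le_power2[of "(x t)^2 - 5/6"] by linarith
    then have "(x t)^2 = (sqrt (5/6))^2"
      by simp
    then show ?thesis
      unfolding power2_eq_iff by blast
  qed simp
  then show ?thesis
    unfolding x_def y_def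
    by (intro lienard_solution_constant[OF sol, of "{0, sqrt (5/6), - sqrt (5/6)}"]) auto
qed

section \<open>Outward restoring force\<close>

text \<open>At a maximum with \<open>x\<close> nonzero, \<open>y\<close> vanishes and the damping
  drops out. What remains of the second derivative of \<open>x^2\<close> is the restoring force
  times \<open>2 * x\<close>, which is positive under the sign conditions.\<close>

lemma lienard_repelling_no_max:
  assumes sol: "solution (lienard_field \<mu> \<beta> \<epsilon>) \<gamma>"
    and "\<epsilon> \<le> 0" "\<beta> \<ge> 0" "\<not> (\<beta> = 0 \<and> \<epsilon> = 0)"
    and max: "\<And>t. (fst (\<gamma> t))^2 \<le> (fst (\<gamma> t0))^2"
  shows "fst (\<gamma> t0) = 0"
proof (rule ccontr)
  define x y where "x t = fst (\<gamma> t)" and "y t = snd (\<gamma> t)" for t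
  note der = lienard_solution_derivatives[OF sol, folded x_def y_def]
  assume "fst (\<gamma> t0) \<noteq> 0"
  then have x0: "x t0 \<noteq> 0"
    by (simp add: x_def)
  have u: "((\<lambda>t. (x t)^2) has_real_derivative 2 * x t * y t) (at t)" for t
    by (rule derivative_eq_intros der refl | simp)+
  have "2 * x t0 * y t0 = 0"
    by (rule DERIV_local_max[OF u, of 1]) (use max in \<open>auto simp: x_def\<close>)
  then have y0: "y t0 = 0"
    using x0 by simp
  have "((\<lambda>t. 2 * x t * y t) has_real_derivative 2 * (\<beta> * (x t0)^2 - \<epsilon> * (x t0)^4)) (at t0)"
    by (rule derivative_eq_intros der refl | simp)+
      (simp add: y0 algebra_simps eval_nat_numeral)
  then have "2 * (\<beta> * (x t0)^2 - \<epsilon> * (x t0)^4) \<le> 0"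
    by (rule max_second_derivative_nonpos[OF u]) (use max in \<open>simp add: x_def\<close>)
  moreover have "\<beta> * (x t0)^2 \<ge> 0" "\<epsilon> * (x t0)^4 \<le> 0"
    using assms by (auto intro!: mult_nonneg_nonneg mult_nonpos_nonneg)
  ultimately have "\<beta> * (x t0)^2 = 0" "\<epsilon> * (x t0)^4 = 0"
    by (simp_all only: right_diff_distrib)
  then show False
    using x0 assms(4) by simp
qed

text \<open>A maximum of \<open>x^2\<close> must be 0, so it suffices that one is attained. Unlike
  in \<open>recurrent\<close>, the limit is an equilibrium here, which places it at
  \<open>x = 0\<close>.\<close>

lemma lienard_repelling_constant:
  assumes sol: "solution (lienard_field \<mu> \<beta> \<epsilon>) \<gamma>"
    and sign: "\<epsilon> \<le> 0" "\<beta> \<ge> 0" "\<not> (\<beta> = 0 \<and> \<epsilon> = 0)"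
    and rec: "(\<exists>T>0. \<forall>t. \<gamma> (t + T) = \<gamma> t) \<or>
      (\<exists>p. lienard_field \<mu> \<beta> \<epsilon> p = 0 \<and> (\<gamma> \<longlongrightarrow> p) at_top \<and> (\<gamma> \<longlongrightarrow> p) at_bot)"
  shows "\<gamma> constant_on UNIV"
proof -
  define u where "u = (\<lambda>t. (fst (\<gamma> t))^2)"
  have "isCont \<gamma> t" for t
    using sol has_vector_derivative_continuous unfolding solution_def by blast
  then have cont: "continuous_on UNIV u"
    unfolding u_def by (intro continuous_at_imp_continuous_on ballI continuous_intros)
  have zero: "u t = 0" if "\<And>t. u t \<le> u t0" for t t0
    using lienard_repelling_no_max[OF sol sign, of t0] that[of t] that by (simp add: u_def)
  have "u t = 0" for t
    using rec
  proof (elim disjE exE conjE)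
    fix T :: real
    assume "0 < T" "\<forall>t. \<gamma> (t + T) = \<gamma> t"
    then show "u t = 0"
      using periodic_attains_max[OF cont, of T] zero unfolding u_def by metis
  next
    fix p
    assume p: "lienard_field \<mu> \<beta> \<epsilon> p = 0" "(\<gamma> \<longlongrightarrow> p) at_top" "(\<gamma> \<longlongrightarrow> p) at_bot"
    have "fst p * (\<beta> - \<epsilon> * (fst p)^2) = 0"
      using p(1) by (auto simp: lienard_field_def case_prod_beta zero_prod_def algebra_simps
          eval_nat_numeral)
    moreover have "\<beta> - \<epsilon> * (fst p)^2 > 0" if "fst p \<noteq> 0"
    proof -
      have "(fst p)^2 > 0"
        using that by simp
      then have "\<epsilon> * (fst p)^2 < 0 \<or> \<epsilon> = 0" "\<epsilon> * (fst p)^2 \<le> 0"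
        using sign by (auto simp: mult_less_0_iff mult_le_0_iff)
      then show ?thesis
        using sign by auto
    qed
    ultimately have "fst p = 0"
      by force
    then have "(u \<longlongrightarrow> 0) at_top" "(u \<longlongrightarrow> 0) at_bot"
      using tendsto_power[OF tendsto_fst[OF p(2)], of 2] tendsto_power[OF tendsto_fst[OF p(3)], of 2]
      by (simp_all add: u_def)
    \<comment> \<open>A positive value would exceed the limit 0, so a maximum would be attained, and
      it would force \<open>u\<close> to vanish.\<close>
    then have "u t > 0 \<Longrightarrow> u t = 0"
      using homoclinic_attains_max[OF cont] zero by metis
    moreover have "u t \<ge> 0"
      by (simp add: u_def)
    ultimately show "u t = 0"
      by force
  qed
  then show ?thesis
    by (intro lienard_solution_constant[OF sol, of "{0}"]) (auto simp: u_def)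
qed

theorem lemma4:
  fixes \<mu> \<beta> \<epsilon> :: real
  assumes "\<not> (\<beta> = 0 \<and> \<epsilon> = 0)"
    and "(\<epsilon> \<le> 0 \<and> \<beta> > 0) \<or>
         (\<epsilon> < 0 \<and> \<beta> = 0) \<or>
         (\<epsilon> > 0 \<and> \<beta> = 0 \<and> \<mu> \<le> - (5/36)) \<or>
         \<mu> \<le> - (1/4)"
  shows "(\<nexists>\<Gamma>. limit_cycle (lienard_field \<mu> \<beta> \<epsilon>) \<Gamma>) \<and>
         (\<nexists>\<Gamma>. homoclinic_loop (lienard_field \<mu> \<beta> \<epsilon>) \<Gamma>)"
proof -
  \<comment> \<open>Periodic orbits and homoclinic loops come from nonconstant solutions, so
    constancy excludes both. The first two conditions fall under the outward force.\<close>
  have "\<gamma> constant_on UNIV"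
    if sol: "solution (lienard_field \<mu> \<beta> \<epsilon>) \<gamma>"
      and rec: "(\<exists>T>0. \<forall>t. \<gamma> (t + T) = \<gamma> t) \<or>
        (\<exists>p. lienard_field \<mu> \<beta> \<epsilon> p = 0 \<and> (\<gamma> \<longlongrightarrow> p) at_top \<and> (\<gamma> \<longlongrightarrow> p) at_bot)" for \<gamma>
  proof -
    have "recurrent \<gamma>"
      using rec unfolding recurrent_def by blast
    then show ?thesis
      using assms sol lienard_repelling_constant[OF sol _ _ assms(1) rec]
        lienard_recurrent_constant_pure_cubic[of \<mu> \<epsilon> \<gamma>]
        lienard_recurrent_constant_dissipative[OF sol]
      by auto
  qed
  then show ?thesis
    unfolding limit_cycle_def periodic_orbit_def homoclinic_loop_def by blast
qed

end
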